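(* Let $k\in\mathbb{N}$ and let $0<b_1<b_2<\cdots<b_k$ be a strictly increasing sequence of positive real numbers. Let $q(x)=(x+b_1)(x+b_2)\cdots(x+b_k)$, and let $p$ be any real polynomial of degree at most $k+1$ whose coefficient of $x^{k+1}$ is non-negative. For $i\in\{1,\dots,k\}$ put $$c_i=\frac{p(-b_i)}{\prod_{j=1,\,j\neq i}^{k}(b_j-b_i)}.$$ If $$\sum_{i=1}^{l}c_i\leq 0\qquad\text{for every } l\in\{1,\dots,k\},$$ then the sequence $\left\{\frac{p(n)}{q(n)}\right\}_{n\in\mathbb{Z}_+}$ is completely alternating.
   Context: $\mathbb{N}=\{1,2,3,\dots\}$ and $\mathbb{Z}_+=\{0,1,2,\dots\}$. Products over the empty set equal $1$. For $a\in\mathbb{Z}_+$ and $\psi:\mathbb{Z}_+\to\mathbb{R}$, $(\nabla_a\psi)(m)=\psi(m)-\psi(m+a)$. A sequence $\psi:\mathbb{Z}_+\to\mathbb{R}$ is completely alternating if $\nabla_{a_1}\cdots\nabla_{a_n}\psi(m)\leq 0$ for all $n\geq 1$, all $a_1,\dots,a_n\in\mathbb{Z}_+$ (repetitions allowed) and all $m\in\mathbb{Z}_+$. *)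

theory Defs
  imports Complex_Main "HOL-Computational_Algebra.Polynomial"
begin

definition nabla :: "nat \<Rightarrow> (nat \<Rightarrow> real) \<Rightarrow> nat \<Rightarrow> real" where
  "nabla a \<psi> m = \<psi> m - \<psi> (m + a)"

(* foldr nabla [a1, ..., an] \<psi> is the iterated difference
   nabla a1 (nabla a2 (... (nabla an \<psi>))); the list is non-empty because the
   iteration has n \<ge> 1 steps, so \<psi> itself is not constrained in sign. *)
definition completely_alternating :: "(nat \<Rightarrow> real) \<Rightarrow> bool" where
  "completely_alternating \<psi> \<longleftrightarrow> (\<forall>as m. as \<noteq> [] \<longrightarrow> foldr nabla as \<psi> m \<le> 0)"

end

theory Submission
  imports Defs
begin

text \<open>
  Partial fractions give \<open>p(x)/q(x) = A x + B + (\<Sum>i. c i / (x + b i))\<close> with \<open>A \<ge> 0\<close>, and Abel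
  summation rewrites the last sum as a combination, with the non-positive partial sums of \<open>c\<close> as
  coefficients, of \<open>1/(x + b k)\<close> and the differences
  \<open>1/(x + b l) - 1/(x + b (l+1)) = (b (l+1) - b l) / ((x + b l) (x + b (l+1)))\<close>. All of these are
  completely monotone: products of completely monotone sequences are completely monotone, and the
  difference of \<open>1/(x + b)\<close> with step \<open>a\<close> is \<open>a\<close> times the product of \<open>1/(x + b)\<close> and \<open>1/(x + b + a)\<close>,
  which permits an induction on the number of differences.
\<close>

text \<open>
  Complete monotonicity up to \<open>n\<close> differences. Bounding the number of differences is what makes the
  induction for \<open>1/(x + b)\<close> possible.
\<close>

primrec monotone_order :: "nat \<Rightarrow> (nat \<Rightarrow> real) \<Rightarrow> bool" where
  "monotone_order 0 f \<longleftrightarrow> (\<forall>m. 0 \<le> f m)"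
| "monotone_order (Suc n) f \<longleftrightarrow> (\<forall>m. 0 \<le> f m) \<and> (\<forall>a. monotone_order n (nabla a f))"

lemma monotone_order_nonneg: "monotone_order n f \<Longrightarrow> 0 \<le> f m"
  by (cases n) auto

lemma monotone_order_Suc_imp: "monotone_order (Suc n) f \<Longrightarrow> monotone_order n f"
  by (induction n arbitrary: f) auto

section \<open>Difference calculus and closure properties\<close>

lemma nabla_add: "nabla a (\<lambda>m. f m + g m) = (\<lambda>m. nabla a f m + nabla a g m)"
  by (simp add: nabla_def fun_eq_iff)

lemma nabla_cmult: "nabla a (\<lambda>m. c * f m) = (\<lambda>m. c * nabla a f m)"
  by (simp add: nabla_def fun_eq_iff algebra_simps)

lemma nabla_shift: "nabla a (\<lambda>m. f (m + d)) = (\<lambda>m. nabla a f (m + d))"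
  by (simp add: nabla_def fun_eq_iff algebra_simps)

text \<open>A discrete Leibniz rule. Evaluating \<open>f\<close> at the shifted point in the second
  term avoids the negative cross term \<open>- nabla a f m * nabla a g m\<close> of the symmetric
  form.\<close>

lemma nabla_mult:
  "nabla a (\<lambda>m. f m * g m) = (\<lambda>m. nabla a f m * g m + f (m + a) * nabla a g m)"
  by (simp add: nabla_def fun_eq_iff algebra_simps)

lemma monotone_order_const: "0 \<le> c \<Longrightarrow> monotone_order n (\<lambda>_. c)"
proof (induction n arbitrary: c)
  case (Suc n)
  have "nabla a (\<lambda>_. c) = (\<lambda>_. 0)" for a
    by (simp add: nabla_def fun_eq_iff)
  then show ?case using Suc.IH[of 0] Suc.prems by simp
qed simp

lemma monotone_order_add:
  "monotone_order n f \<Longrightarrow> monotone_order n g \<Longrightarrow> monotone_order n (\<lambda>m. f m + g m)"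
  by (induction n arbitrary: f g) (auto simp: nabla_add)

lemma monotone_order_cmult:
  "0 \<le> c \<Longrightarrow> monotone_order n f \<Longrightarrow> monotone_order n (\<lambda>m. c * f m)"
  by (induction n arbitrary: f) (auto simp: nabla_cmult)

lemma monotone_order_shift: "monotone_order n f \<Longrightarrow> monotone_order n (\<lambda>m. f (m + d))"
  by (induction n arbitrary: f) (auto simp: nabla_shift)

text \<open>In each Leibniz term one factor is a difference and has order \<open>n\<close> by
  definition; the other is undifferenced, possibly shifted, and drops from order
  \<open>Suc n\<close> to \<open>n\<close>.\<close>

lemma monotone_order_mult:
  "monotone_order n f \<Longrightarrow> monotone_order n g \<Longrightarrow> monotone_order n (\<lambda>m. f m * g m)"
proof (induction n arbitrary: f g)
  case (Suc n)
  have "monotone_order n (nabla a (\<lambda>m. f m * g m))" for a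
    unfolding nabla_mult
  proof (intro monotone_order_add Suc.IH)
    show "monotone_order n (nabla a f)" "monotone_order n (nabla a g)"
      using Suc.prems by simp_all
    show "monotone_order n g" "monotone_order n (\<lambda>m. f (m + a))"
      using Suc.prems monotone_order_Suc_imp monotone_order_shift by blast+
  qed
  moreover have "0 \<le> f m * g m" for m
    using Suc.prems monotone_order_nonneg by (meson mult_nonneg_nonneg)
  ultimately show ?case by simp
qed simp

section \<open>Reciprocals of linear functions\<close>

text \<open>A difference turns the reciprocal into a product of reciprocals with parameters
  \<open>b\<close> and \<open>b + real a\<close>, needed only at one order less; hence the induction
  over all \<open>b\<close> at once.\<close>

lemma monotone_order_recip: "0 < b \<Longrightarrow> monotone_order n (\<lambda>m. 1 / (real m + b))"
proof (induction n arbitrary: b)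
  case (Suc n)
  have "monotone_order n (nabla a (\<lambda>m. 1 / (real m + b)))" for a
  proof -
    have "nabla a (\<lambda>m. 1 / (real m + b)) =
        (\<lambda>m. real a * (1 / (real m + b) * (1 / (real m + (b + real a)))))"
    proof
      fix m
      have "real m + b > 0" "real m + (b + real a) > 0" using Suc.prems by simp_all
      then show "nabla a (\<lambda>m. 1 / (real m + b)) m =
          real a * (1 / (real m + b) * (1 / (real m + (b + real a))))"
        by (simp add: nabla_def field_simps)
    qed
    moreover have "0 < b + real a" using Suc.prems by simp
    ultimately show ?thesis
      using Suc.IH Suc.prems by (simp only: monotone_order_cmult monotone_order_mult of_nat_0_le_iff)
  qed
  then show ?case using Suc.prems by simp
qed simp

lemma monotone_order_recip_diff:
  assumes "0 < b" "b \<le> b'"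
  shows "monotone_order n (\<lambda>m. 1 / (real m + b) - 1 / (real m + b'))"
proof -
  have "(\<lambda>m. 1 / (real m + b) - 1 / (real m + b')) =
      (\<lambda>m. (b' - b) * (1 / (real m + b) * (1 / (real m + b'))))"
  proof
    fix m
    have "real m + b > 0" "real m + b' > 0" using assms by simp_all
    then show "1 / (real m + b) - 1 / (real m + b') =
        (b' - b) * (1 / (real m + b) * (1 / (real m + b')))"
      by (simp add: divide_simps)
  qed
  then show ?thesis
    using assms by (simp only: monotone_order_cmult monotone_order_mult monotone_order_recip
        diff_ge_0_iff_ge less_le_trans)
qed

lemma monotone_order_sum_recip:
  fixes b d :: "nat \<Rightarrow> real"
  assumes "1 \<le> k" and pos: "\<And>i. i \<in> {1..k} \<Longrightarrow> 0 < b i" and mono: "mono_on {1..k} b"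
    and partial: "\<And>l. l \<in> {1..k} \<Longrightarrow> 0 \<le> (\<Sum>i=1..l. d i)"
  shows "monotone_order n (\<lambda>m. \<Sum>i=1..k. d i * (1 / (real m + b i)))"
proof -
  define f where "f i m = 1 / (real m + b i)" for i m
  \<comment> \<open>Writing \<open>S i\<close> for the partial sums of \<open>d\<close>, this
    function is the sum over \<open>i < l\<close> of \<open>S i * (f i m - f (Suc i) m)\<close>:
    zero for \<open>l = 1\<close>, with one new term per step.\<close>
  have abel: "monotone_order n (\<lambda>m. (\<Sum>i=1..l. d i * f i m) - (\<Sum>i=1..l. d i) * f l m)"
    if "1 \<le> l" "l \<le> k" for l
    using that
  proof (induction l rule: dec_induct)
    case base
    show ?case by (simp add: monotone_order_const)
  next
    case (step l)
    have "monotone_order n (\<lambda>m. f l m - f (Suc l) m)"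
      unfolding f_def using step.hyps step.prems
      by (intro monotone_order_recip_diff pos mono_onD[OF mono]) auto
    then have "monotone_order n (\<lambda>m. (\<Sum>i=1..l. d i) * (f l m - f (Suc l) m))"
      using step.hyps step.prems by (intro monotone_order_cmult partial) auto
    then have "monotone_order n (\<lambda>m. ((\<Sum>i=1..l. d i * f i m) - (\<Sum>i=1..l. d i) * f l m)
        + (\<Sum>i=1..l. d i) * (f l m - f (Suc l) m))"
      using step.IH step.prems by (intro monotone_order_add) auto
    then show ?case by (simp add: algebra_simps)
  qed
  \<comment> \<open>The boundary term of the Abel summation, added back at
    \<open>l = k\<close>.\<close>
  have "monotone_order n (\<lambda>m. (\<Sum>i=1..k. d i) * f k m)"
    unfolding f_def using assms(1)
    by (intro monotone_order_cmult partial monotone_order_recip pos) auto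
  from monotone_order_add[OF abel[OF assms(1) order_refl] this] show ?thesis
    by (simp add: f_def)
qed

section \<open>From complete monotonicity to complete alternation\<close>

text \<open>\<open>foldr\<close> applies the last list entry first, so induction from the end of the
  list matches the recursion of \<open>monotone_order\<close>.\<close>

lemma foldr_nabla_nonneg: "monotone_order (length as) f \<Longrightarrow> 0 \<le> foldr nabla as f m"
proof (induction as arbitrary: f rule: rev_induct)
  case (snoc a as)
  then show ?case by simp
qed simp

lemma foldr_nabla_uminus: "foldr nabla as (\<lambda>m. - f m) = (\<lambda>m. - foldr nabla as f m)"
  by (induction as) (simp_all add: nabla_def fun_eq_iff)

text \<open>A non-empty list has an innermost difference; once it is split off, the remaining ones
  act on a completely monotone sequence up to sign.\<close>

lemma completely_alternatingI:
  assumes "\<And>n a. monotone_order n (\<lambda>m. - nabla a f m)"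
  shows "completely_alternating f"
  unfolding completely_alternating_def
proof (intro allI impI)
  fix as :: "nat list" and m
  assume "as \<noteq> []"
  then obtain bs a where as: "as = bs @ [a]" by (metis rev_exhaust)
  have "0 \<le> foldr nabla bs (\<lambda>m. - nabla a f m) m"
    by (rule foldr_nabla_nonneg) (rule assms)
  then show "foldr nabla as f m \<le> 0"
    by (simp add: as foldr_nabla_uminus)
qed

text \<open>A difference kills \<open>B\<close> and makes the linear term the constant
  \<open>- A * real a\<close>; the order spent on differencing \<open>g\<close> is why
  \<open>Suc n\<close> is used.\<close>

lemma completely_alternating_affine_minus:
  assumes "0 \<le> A" and g: "\<And>n. monotone_order n g"
  shows "completely_alternating (\<lambda>m. A * real m + B - g m)"
proof (rule completely_alternatingI)
  fix n a
  have "monotone_order n (\<lambda>m. A * real a + nabla a g m)"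
    using assms(1) g[of "Suc n"] by (intro monotone_order_add monotone_order_const) simp_all
  moreover have "(\<lambda>m. - nabla a (\<lambda>m. A * real m + B - g m) m) = (\<lambda>m. A * real a + nabla a g m)"
    by (simp add: nabla_def fun_eq_iff algebra_simps)
  ultimately show "monotone_order n (\<lambda>m. - nabla a (\<lambda>m. A * real m + B - g m) m)" by simp
qed

section \<open>Partial fractions\<close>

text \<open>Divide \<open>p\<close> by the monic \<open>q\<close>: the quotient gives the affine
  part, and Lagrange interpolation of the remainder at the roots of \<open>q\<close> gives the
  fractions.\<close>

lemma partial_fractions_linear_factors:
  fixes p :: "real poly" and b :: "'a \<Rightarrow> real"
  assumes "finite I" "I \<noteq> {}" and inj: "inj_on b I"
    and deg: "degree p \<le> card I + 1"
  obtains B where "\<And>x. (\<And>i. i \<in> I \<Longrightarrow> x + b i \<noteq> 0) \<Longrightarrow>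
    poly p x / (\<Prod>i\<in>I. x + b i) = coeff p (card I + 1) * x + B
      + (\<Sum>i\<in>I. poly p (- b i) / (\<Prod>j\<in>I - {i}. b j - b i) * (1 / (x + b i)))"
proof -
  define q where "q = (\<Prod>i\<in>I. [:b i, 1:])"
  define c where "c i = poly p (- b i) / (\<Prod>j\<in>I - {i}. b j - b i)" for i
  define L where "L i = (\<Prod>j\<in>I - {i}. [:b j, 1:])" for i
  have card_pos: "0 < card I" using assms by (simp add: card_gt_0_iff)
  have q_deg: "degree q = card I"
    unfolding q_def by (subst degree_prod_sum_eq) auto
  have q0: "q \<noteq> 0" using q_deg card_pos by auto
  have q_lc: "lead_coeff q = 1" unfolding q_def by (simp add: lead_coeff_prod)
  have q_poly: "poly q x = (\<Prod>i\<in>I. x + b i)" for x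
    by (simp add: q_def poly_prod add.commute)
  have L_poly: "poly (L i) x = (\<Prod>j\<in>I - {i}. x + b j)" for i x
    by (simp add: L_def poly_prod add.commute)
  have q_root: "poly q (- b i) = 0" if "i \<in> I" for i
    using that assms(1) by (auto simp: q_poly)
  have mod_deg: "degree (p mod q) < card I"
    using degree_mod_less[OF q0, of p] card_pos q_deg by auto
  \<comment> \<open>Both sides have degree below \<open>card I\<close> and agree at the
    \<open>card I\<close> distinct points \<open>- b i\<close>, where \<open>p mod q\<close> takes
    the values of \<open>p\<close>.\<close>
  have mod_eq: "p mod q = (\<Sum>i\<in>I. smult (c i) (L i))"
  proof (rule poly_eqI_degree)
    show "degree (p mod q) < card ((\<lambda>i. - b i) ` I)"
      using mod_deg inj by (simp add: card_image inj_on_def)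
    have "degree (L i) \<le> card I - 1" if "i \<in> I" for i
      unfolding L_def using that assms(1) by (subst degree_prod_sum_eq) auto
    then have "degree (\<Sum>i\<in>I. smult (c i) (L i)) \<le> card I - 1"
      by (intro degree_sum_le assms(1)) (meson degree_smult_le order_trans)
    then show "degree (\<Sum>i\<in>I. smult (c i) (L i)) < card ((\<lambda>i. - b i) ` I)"
      using card_pos inj by (simp add: card_image inj_on_def)
  next
    fix x assume "x \<in> (\<lambda>i. - b i) ` I"
    then obtain i where i: "i \<in> I" and x: "x = - b i" by auto
    have "poly p x = poly (p div q * q + p mod q) x" by simp
    then have "poly (p mod q) x = poly p x"
      using q_root[OF i] by (simp only: poly_add poly_mult x)
    \<comment> \<open>For \<open>j\<close> other than \<open>i\<close>, the product
      \<open>L j\<close> still contains the factor vanishing at \<open>- b i\<close>.\<close>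
    moreover have "poly (L j) x = 0" if "j \<in> I - {i}" for j
      using that i assms(1) by (auto simp: L_poly x)
    then have "poly (\<Sum>i\<in>I. smult (c i) (L i)) x = c i * poly (L i) x"
      using i assms(1) by (simp add: poly_sum sum.remove)
    moreover have "poly (L i) x = (\<Prod>j\<in>I - {i}. b j - b i)"
      by (simp add: L_poly x algebra_simps)
    moreover have "(\<Prod>j\<in>I - {i}. b j - b i) \<noteq> 0"
      using i inj assms(1) by (auto simp: inj_on_def)
    ultimately show "poly (p mod q) x = poly (\<Sum>i\<in>I. smult (c i) (L i)) x"
      by (simp add: c_def x)
  qed
  have div_deg: "degree (p div q) \<le> 1"
  proof (cases "p div q = 0")
    case False
    have "degree (p div q) + card I = degree (p div q * q)"
      using False q0 q_deg by (simp add: degree_mult_eq)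
    also have "\<dots> = degree (p - p mod q)" by (simp add: minus_mod_eq_div_mult)
    also have "\<dots> \<le> card I + 1" using deg mod_deg by (intro degree_diff_le) simp_all
    finally show ?thesis by simp
  qed simp
  have "coeff (p div q) 1 = coeff p (card I + 1)"
  proof -
    have "coeff p (card I + 1) = coeff (p div q * q + p mod q) (1 + degree q)"
      by (simp add: q_deg)
    also have "\<dots> = coeff (p div q * q) (1 + degree q)"
      unfolding coeff_add using mod_deg by (simp add: coeff_eq_0 q_deg)
    also have "\<dots> = coeff (p div q) 1"
    \<comment> \<open>For a linear quotient this is the product of leading coefficients, with
      \<open>q\<close> monic; for a constant one both coefficients vanish.\<close>
    proof (cases "degree (p div q) = 1")
      case True
      then show ?thesis using coeff_mult_degree_sum[of "p div q" q] q_lc by simp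
    next
      case False
      then have "degree (p div q) = 0" using div_deg by simp
      then have "degree (p div q * q) < 1 + degree q"
        using degree_mult_le[of "p div q" q] by simp
      with \<open>degree (p div q) = 0\<close> show ?thesis by (simp only: coeff_eq_0)
    qed
    finally show ?thesis by simp
  qed
  moreover have "p div q = [:coeff (p div q) 0, coeff (p div q) 1:]"
    using div_deg by (intro poly_eqI) (auto simp: coeff_pCons coeff_eq_0 split: nat.split)
  then have "poly (p div q) x = coeff (p div q) 1 * x + coeff (p div q) 0" for x
    by (metis add.commute mult.commute mult_zero_right add.right_neutral poly_0 poly_pCons)
  ultimately have div_poly: "poly (p div q) x = coeff p (card I + 1) * x + coeff (p div q) 0" for x
    by simp
  show ?thesis
  proof (rule that[of "coeff (p div q) 0"])
    fix x assume x: "\<And>i. i \<in> I \<Longrightarrow> x + b i \<noteq> 0"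
    have qx: "poly q x \<noteq> 0" using x assms(1) by (simp add: q_poly)
    have Lx: "poly (L i) x / poly q x = 1 / (x + b i)" if "i \<in> I" for i
    proof -
      have "poly q x = (x + b i) * poly (L i) x"
        using that assms(1) by (simp add: q_poly L_poly prod.remove)
      then show ?thesis using qx by simp
    qed
    have "poly p x = poly (p div q * q + p mod q) x" by simp
    then have "poly p x / poly q x = poly (p div q) x + poly (p mod q) x / poly q x"
      using qx by (simp only: poly_add poly_mult) (simp add: field_simps)
    also have "poly (p mod q) x / poly q x = (\<Sum>i\<in>I. c i * (poly (L i) x / poly q x))"
      by (simp add: mod_eq poly_sum sum_divide_distrib)
    also have "\<dots> = (\<Sum>i\<in>I. c i * (1 / (x + b i)))"
      using Lx by (intro sum.cong) simp_all
    finally show "poly p x / (\<Prod>i\<in>I. x + b i) =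
        coeff p (card I + 1) * x + coeff (p div q) 0
        + (\<Sum>i\<in>I. poly p (- b i) / (\<Prod>j\<in>I - {i}. b j - b i) * (1 / (x + b i)))"
      by (simp only: div_poly q_poly c_def)
  qed
qed

theorem theorem1p5:
  fixes k :: nat and b c :: "nat \<Rightarrow> real" and p q :: "real poly"
  assumes "k \<ge> 1"
    and "\<And>i. i \<in> {1..k} \<Longrightarrow> 0 < b i"
    and "strict_mono_on {1..k} b"
    and "q = (\<Prod>i\<in>{1..k}. [:b i, 1:])"
    and "degree p \<le> k + 1"
    and "coeff p (k + 1) \<ge> 0"
    and "\<And>i. i \<in> {1..k} \<Longrightarrow> c i = poly p (- b i) / (\<Prod>j\<in>{1..k} - {i}. b j - b i)"
    and "\<And>l. l \<in> {1..k} \<Longrightarrow> (\<Sum>i=1..l. c i) \<le> 0"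
  shows "completely_alternating (\<lambda>n. poly p (real n) / poly q (real n))"
proof -
  \<comment> \<open>The sign change makes the partial sums non-negative, as the Abel summation lemma
    requires.\<close>
  define g where "g n = (\<Sum>i=1..k. - c i * (1 / (real n + b i)))" for n
  have g: "monotone_order n g" for n
    unfolding g_def using assms(1,2,8) strict_mono_on_imp_mono_on[OF assms(3)]
    by (intro monotone_order_sum_recip) (auto simp: sum_negf)
  obtain B where B: "\<And>x. (\<And>i. i \<in> {1..k} \<Longrightarrow> x + b i \<noteq> 0) \<Longrightarrow>
      poly p x / (\<Prod>i\<in>{1..k}. x + b i) = coeff p (k + 1) * x + B
      + (\<Sum>i\<in>{1..k}. poly p (- b i) / (\<Prod>j\<in>{1..k} - {i}. b j - b i) * (1 / (x + b i)))"
    using partial_fractions_linear_factors[of "{1..k}" b p] assms(1,5)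
      strict_mono_on_imp_inj_on[OF assms(3)] by (auto simp del: One_nat_def)
  have "poly p (real n) / poly q (real n) = coeff p (k + 1) * real n + B - g n" for n
  proof -
    have "real n + b i \<noteq> 0" if "i \<in> {1..k}" for i
      using assms(2)[OF that] by (simp add: add_nonneg_pos less_imp_neq)
    then have "poly p (real n) / (\<Prod>i\<in>{1..k}. real n + b i) = coeff p (k + 1) * real n + B
        + (\<Sum>i\<in>{1..k}. c i * (1 / (real n + b i)))"
      by (subst B) (simp_all add: assms(7))
    moreover have "poly q (real n) = (\<Prod>i\<in>{1..k}. real n + b i)"
      by (simp add: assms(4) poly_prod add.commute)
    ultimately show ?thesis by (simp add: g_def sum_negf)
  qed
  then show ?thesis
    using completely_alternating_affine_minus[of "coeff p (k + 1)" g B] assms(6) g by simp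
qed

end
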